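(* Consider an instance $(X,U)$ of dimension $n$ of a problem class with cardinality bounds $\underline p,\bar p$ and cost bounds $0<m_\infty\le M_\infty$. Let $M(n):=M_\infty\,\bar p(n)-m_\infty\,\underline p(n)$, let $a:\mathbb N\to\mathbb R_+$ with $M(n)+a(n)>0$, and let $k=n-l$ with $l\in[n-1]$. Then, for all $$l\in\left[0,\ \min\left\{n-1,\ \frac{a(n)\,n}{M(n)+a(n)}\right\}\right]\cap\mathbb N,$$ the solution returned by the selection algorithm (Algorithm 1, described in the context) has additive approximation guarantee at most $a(n)$, i.e. $\mathrm{approx}(k)\le\mathrm{opt}(k)+a(n)$.
   Context: Notation: $\mathbb N=\{1,2,\dots\}$, $[k]=\{1,\dots,k\}$, $\mathbb R_+^n=\{x\in\mathbb R^n: x\ge 0\}$, and $\|x\|_0$ is the number of non-zero entries of $x$. An instance of dimension $n$ consists of a nonempty set $X\subseteq\{0,1\}^n$ and a nonempty convex set $U\subseteq\mathbb R_+^n$; all minima and maxima written are understood to be attained (e.g. $U$ compact). For $k\in\mathbb N$ the min-max-min robust problem $(\mathrm M^3(k))$ is $$\min_{x^{(1)},\dots,x^{(k)}\in X}\ \max_{c\in U}\ \min_{i=1,\dots,k} c^\top x^{(i)},$$ and $\mathrm{opt}(k)$ denotes its optimal value. A problem class has cardinality bounds $\underline p,\bar p:\mathbb N\to\mathbb R_+$ if for every instance of dimension $n$ in the class $\underline p(n)\le\|x\|_0\le\bar p(n)$ for all $x\in X$. Cost bounds $0<m_\infty\le M_\infty$ means that $m_\infty\le c_j\le M_\infty$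 for all $c\in U$ and all $j\in[n]$. Algorithm 1 (input $n$, $k\in[n]$, $U$, $X$): (1) compute an optimal solution $x^1,\dots,x^n$ of $(\mathrm M^3(n))$; (2) compute an optimal solution $\lambda^*$ of $\min\{\max_{c\in U}c^\top x:\ x=\sum_{i=1}^n\lambda_i x^i,\ \sum_{i=1}^n\lambda_i=1,\ \lambda\ge 0\}$; (3) sort $\lambda^*_{i_1}\ge\lambda^*_{i_2}\ge\dots\ge\lambda^*_{i_n}$; (4) return $x^{i_1},\dots,x^{i_k}$. The objective value of the returned solution is $\mathrm{approx}(k):=\max_{c\in U}\min_{j=1,\dots,k}c^\top x^{i_j}$. *)

theory Defs
  imports "HOL-Analysis.Analysis"
begin

text \<open>An instance of dimension \<open>n = CARD('n)\<close> is a pair \<open>(X, U)\<close> of sets of vectors in \<open>real ^ 'n\<close>;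
  \<open>X\<close> consists of 0/1 vectors, embedded in the reals.\<close>

definition l0 :: "real ^ 'n \<Rightarrow> nat" where
  "l0 x = card {j. x $ j \<noteq> 0}"

definition m3_instance :: "(real ^ 'n) set \<Rightarrow> (real ^ 'n) set \<Rightarrow> bool" where
  "m3_instance X U \<longleftrightarrow>
     X \<noteq> {} \<and> (\<forall>x\<in>X. \<forall>j. x $ j \<in> {0, 1}) \<and>
     U \<noteq> {} \<and> convex U \<and> (\<forall>c\<in>U. \<forall>j. 0 \<le> c $ j)"

text \<open>Since the dimension is a type, \<open>C\<close> is the set of those instances of a problem class that have
  dimension \<open>CARD('n)\<close>. The bounds remain functions of the dimension. Instances of other dimensions
  are not constrained, so the slice of any problem class with these bounds satisfies this predicate.\<close>

definition problem_class :: "((real ^ 'n) set \<times> (real ^ 'n) set) set \<Rightarrow> bool" where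
  "problem_class C \<longleftrightarrow> (\<forall>(X, U)\<in>C. m3_instance X U)"

definition cardinality_bounds ::
    "((real ^ 'n) set \<times> (real ^ 'n) set) set \<Rightarrow> (nat \<Rightarrow> real) \<Rightarrow> (nat \<Rightarrow> real) \<Rightarrow> bool" where
  "cardinality_bounds C p_lo p_up \<longleftrightarrow>
     (\<forall>m\<ge>1. 0 \<le> p_lo m \<and> 0 \<le> p_up m) \<and>
     (\<forall>(X, U)\<in>C. \<forall>x\<in>X. p_lo CARD('n) \<le> real (l0 x) \<and> real (l0 x) \<le> p_up CARD('n))"

definition cost_bounds :: "(real ^ 'n) set \<Rightarrow> real \<Rightarrow> real \<Rightarrow> bool" where
  "cost_bounds U m_inf M_inf \<longleftrightarrow>
     0 < m_inf \<and> m_inf \<le> M_inf \<and> (\<forall>c\<in>U. \<forall>j. m_inf \<le> c $ j \<and> c $ j \<le> M_inf)"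

text \<open>Tuples \<open>(x\<^sup>1, \<dots>, x\<^sup>k)\<close> over \<open>X\<close> are extensional functions on \<open>{1..k}\<close>.\<close>

abbreviation tuples :: "nat \<Rightarrow> 'a set \<Rightarrow> (nat \<Rightarrow> 'a) set" where
  "tuples k X \<equiv> {1..k} \<rightarrow>\<^sub>E X"

definition scenario_value :: "nat \<Rightarrow> (nat \<Rightarrow> real ^ 'n) \<Rightarrow> real ^ 'n \<Rightarrow> real" where
  "scenario_value k x c = (MIN i\<in>{1..k}. c \<bullet> x i)"

text \<open>Maxima over \<open>U\<close> and minima over the feasible set are written as \<open>SUP\<close> and \<open>INF\<close>; that they are
  attained is the standing assumption \<open>optima_attained\<close> below.\<close>

definition m3_objective :: "(real ^ 'n) set \<Rightarrow> nat \<Rightarrow> (nat \<Rightarrow> real ^ 'n) \<Rightarrow> real" where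
  "m3_objective U k x = (SUP c\<in>U. scenario_value k x c)"

definition m3_opt :: "(real ^ 'n) set \<Rightarrow> (real ^ 'n) set \<Rightarrow> nat \<Rightarrow> real" where
  "m3_opt X U k = (INF x\<in>tuples k X. m3_objective U k x)"

definition m3_optimal ::
    "(real ^ 'n) set \<Rightarrow> (real ^ 'n) set \<Rightarrow> nat \<Rightarrow> (nat \<Rightarrow> real ^ 'n) \<Rightarrow> bool" where
  "m3_optimal X U k x \<longleftrightarrow> is_arg_min (m3_objective U k) (\<lambda>x. x \<in> tuples k X) x"

definition simplex_weights :: "nat \<Rightarrow> (nat \<Rightarrow> real) set" where
  "simplex_weights n = {w. (\<Sum>i=1..n. w i) = 1 \<and> (\<forall>i\<in>{1..n}. 0 \<le> w i)}"

definition combination :: "nat \<Rightarrow> (nat \<Rightarrow> real ^ 'n) \<Rightarrow> (nat \<Rightarrow> real) \<Rightarrow> real ^ 'n" where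
  "combination n x w = (\<Sum>i=1..n. w i *\<^sub>R x i)"

definition weights_objective ::
    "(real ^ 'n) set \<Rightarrow> nat \<Rightarrow> (nat \<Rightarrow> real ^ 'n) \<Rightarrow> (nat \<Rightarrow> real) \<Rightarrow> real" where
  "weights_objective U n x w = (SUP c\<in>U. c \<bullet> combination n x w)"

definition weights_optimal ::
    "(real ^ 'n) set \<Rightarrow> nat \<Rightarrow> (nat \<Rightarrow> real ^ 'n) \<Rightarrow> (nat \<Rightarrow> real) \<Rightarrow> bool" where
  "weights_optimal U n x w \<longleftrightarrow>
     is_arg_min (weights_objective U n x) (\<lambda>w. w \<in> simplex_weights n) w"

definition optima_attained :: "(real ^ 'n) set \<Rightarrow> (real ^ 'n) set \<Rightarrow> bool" where
  "optima_attained X U \<longleftrightarrow>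
     (\<forall>k\<ge>1. (\<forall>x\<in>tuples k X. \<exists>c. is_arg_max (scenario_value k x) (\<lambda>c. c \<in> U) c) \<and>
            (\<exists>x. m3_optimal X U k x)) \<and>
     (\<forall>x\<in>tuples CARD('n) X.
        (\<forall>w\<in>simplex_weights CARD('n).
           \<exists>c. is_arg_max (\<lambda>c. c \<bullet> combination CARD('n) x w) (\<lambda>c. c \<in> U) c) \<and>
        (\<exists>w. weights_optimal U CARD('n) x w))"

text \<open>The selection algorithm is nondeterministic (choice of optimal solutions, ties in the sorting),
  hence a relation: \<open>y\<close> is a possible output. The index \<open>i\<^sub>j\<close> of the sorted order is \<open>\<sigma> j\<close>.\<close>

definition selection_output ::
    "(real ^ 'n) set \<Rightarrow> (real ^ 'n) set \<Rightarrow> nat \<Rightarrow> (nat \<Rightarrow> real ^ 'n) \<Rightarrow> bool" where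
  "selection_output X U k y \<longleftrightarrow>
     (\<exists>x w \<sigma>. m3_optimal X U CARD('n) x \<and>
        weights_optimal U CARD('n) x w \<and>
        bij_betw \<sigma> {1..CARD('n)} {1..CARD('n)} \<and>
        (\<forall>i\<in>{1..CARD('n)}. \<forall>j\<in>{1..CARD('n)}. i \<le> j \<longrightarrow> w (\<sigma> j) \<le> w (\<sigma> i)) \<and>
        y = (\<lambda>j\<in>{1..k}. x (\<sigma> j)))"

end

theory Submission
  imports Defs
begin

text \<open>By separation of convex sets, the optimal weights \<open>w\<close> over an optimal \<open>n\<close>-tuple achieve at most
  \<open>opt(n) \<le> opt(k)\<close> in every scenario. The \<open>l\<close> smallest weights sum to at most \<open>l / n\<close>. All scenario
  costs lie in an interval of length \<open>M(n)\<close>, so dropping the corresponding solutions costs at most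
  \<open>l / n * M(n) \<le> a(n)\<close> in every scenario.\<close>

section \<open>Convex separation and tails of decreasing sequences\<close>

text \<open>This is the minimax step. Sending a scenario to the vector of its costs on the points
  \<open>x i\<close> maps \<open>U\<close> to a convex set, which by hypothesis misses the open
  orthant of vectors with all coordinates above \<open>t\<close>. The normal of a separating
  hyperplane is non-negative, and scaled to sum one it gives the weights.\<close>

lemma convex_weights_le_if_min_le:
  fixes U :: "'a::real_inner set" and x :: "'i::finite \<Rightarrow> 'a"
  assumes "convex U" and "U \<noteq> {}" and le: "\<And>c. c \<in> U \<Longrightarrow> \<exists>i. c \<bullet> x i \<le> t"
  shows "\<exists>w. (\<forall>i. 0 \<le> w i) \<and> (\<Sum>i\<in>UNIV. w i) = 1 \<and> (\<forall>c\<in>U. c \<bullet> (\<Sum>i\<in>UNIV. w i *\<^sub>R x i) \<le> t)"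
proof -
  define f where "f c = (\<chi> i. c \<bullet> x i)" for c
  define B where "B = {z :: real ^ 'i. \<forall>i. t < z $ i}"
  have "linear f"
    unfolding f_def by (rule linearI) (simp_all add: vec_eq_iff inner_add_left)
  then have convex_fU: "convex (f ` U)"
    using \<open>convex U\<close> by (rule convex_linear_image)
  have convex_B: "convex B"
    unfolding B_def using convex_box_cart[of "\<lambda>_ u. t < u"] convex_real_interval(3)[of t]
    by (simp add: greaterThan_def)
  have inB: "(\<chi> i. s i) \<in> B" if "\<And>i. t < s i" for s
    using that by (simp add: B_def)
  have disjoint: "f ` U \<inter> B = {}"
  proof -
    have "f c \<notin> B" if "c \<in> U" for c
      using le[OF that] by (auto simp: f_def B_def not_less)
    then show ?thesis
      by auto
  qed
  have "f ` U \<noteq> {}" and "B \<noteq> {}"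
    using \<open>U \<noteq> {}\<close> inB[of "\<lambda>_. t + 1"] by auto
  then have "\<exists>v b. v \<noteq> 0 \<and> (\<forall>z\<in>f ` U. v \<bullet> z \<le> b) \<and> (\<forall>z\<in>B. b \<le> v \<bullet> z)"
    using convex_fU convex_B disjoint by (intro separating_hyperplane_sets)
  then obtain v b where "v \<noteq> 0"
    and U_le: "\<And>c. c \<in> U \<Longrightarrow> v \<bullet> f c \<le> b" and B_ge: "\<And>z. z \<in> B \<Longrightarrow> b \<le> v \<bullet> z"
    by blast
  define s where "s = (\<Sum>i\<in>UNIV. v $ i)"
  have nonneg: "0 \<le> v $ i" for i
  proof (rule ccontr)
    assume neg: "\<not> 0 \<le> v $ i"
    \<comment> \<open>The orthant is unbounded in direction \<open>i\<close>, so a negative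
      \<open>v $ i\<close> would let \<open>v \<bullet> z\<close> fall without limit. This
      \<open>r\<close> is large enough to push the value to at most \<open>b - 1\<close>; the
      \<open>max\<close> with 0 keeps the point inside \<open>B\<close>.\<close>
    define r where "r = max 0 ((b - (t + 1) * s - 1) / v $ i)"
    have "0 \<le> r"
      by (simp add: r_def)
    then have "b \<le> v \<bullet> (\<chi> j. t + 1 + (if j = i then r else 0))"
      by (intro B_ge inB) simp
    also have "\<dots> = (t + 1) * s + v $ i * r"
      by (simp add: inner_vec_def s_def distrib_left sum.distrib sum_distrib_left mult.commute
          if_distrib[of "\<lambda>u. _ * u"] cong: if_cong)
    also have "v $ i * r \<le> b - (t + 1) * s - 1"
    proof -
      have "(b - (t + 1) * s - 1) / v $ i \<le> r"
        by (simp add: r_def)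
      with neg show ?thesis
        by (simp add: field_simps)
    qed
    finally show False
      by simp
  qed
  have "s \<noteq> 0"
    using \<open>v \<noteq> 0\<close> nonneg by (simp add: s_def sum_nonneg_eq_0_iff vec_eq_iff)
  then have "0 < s"
    using nonneg by (simp add: s_def order_less_le sum_nonneg)
  \<comment> \<open>The corner with all coordinates \<open>t\<close> is not in the open set
    \<open>B\<close>. It is approached from inside, with offset \<open>e / s\<close> chosen so that
    the value exceeds \<open>t * s\<close> by exactly \<open>e\<close>.\<close>
  have "b \<le> t * s"
  proof (rule field_le_epsilon)
    fix e :: real
    assume "0 < e"
    then have "b \<le> v \<bullet> (\<chi> i. t + e / s)"
      using \<open>0 < s\<close> by (intro B_ge inB) simp
    also have "\<dots> = t * s + e"
      using \<open>0 < s\<close> by (simp add: inner_vec_def s_def flip: sum_distrib_right) (simp add: field_simps)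
    finally show "b \<le> t * s + e" .
  qed
  have "c \<bullet> (\<Sum>i\<in>UNIV. (v $ i / s) *\<^sub>R x i) \<le> t" if "c \<in> U" for c
  proof -
    have "c \<bullet> (\<Sum>i\<in>UNIV. (v $ i / s) *\<^sub>R x i) = v \<bullet> f c / s"
      by (simp add: f_def inner_vec_def inner_sum_right sum_divide_distrib)
    also have "\<dots> \<le> t"
      using U_le[OF that] \<open>b \<le> t * s\<close> \<open>0 < s\<close> by (simp add: divide_le_eq)
    finally show ?thesis .
  qed
  moreover have "(\<Sum>i\<in>UNIV. v $ i / s) = 1"
    using \<open>s \<noteq> 0\<close> by (simp add: s_def flip: sum_divide_distrib)
  ultimately show ?thesis
    using nonneg \<open>0 < s\<close> by (intro exI[of _ "\<lambda>i. v $ i / s"]) simp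
qed

text \<open>Every tail term is at most \<open>v k\<close> and every head term at least
  \<open>v k\<close>, so the average over the tail is at most the average over the head, and hence
  at most the overall average. The claim is this comparison with denominators cleared.\<close>

lemma decreasing_tail_sum_le:
  fixes v :: "nat \<Rightarrow> real"
  assumes "1 \<le> k" and "k \<le> n"
    and dec: "\<And>i j. i \<in> {1..n} \<Longrightarrow> j \<in> {1..n} \<Longrightarrow> i \<le> j \<Longrightarrow> v j \<le> v i"
  shows "real n * (\<Sum>j=k+1..n. v j) \<le> real (n - k) * (\<Sum>j=1..n. v j)"
proof -
  have tail: "(\<Sum>j=k+1..n. v j) \<le> real (n - k) * v k"
    using sum_bounded_above[of "{k+1..n}" v "v k"] dec[of k] assms(1,2) by simp
  have head: "real k * v k \<le> (\<Sum>j=1..k. v j)"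
    using sum_bounded_below[of "{1..k}" "v k" v] dec[of _ k] assms(1,2) by simp
  have "real k * (\<Sum>j=k+1..n. v j) \<le> real (n - k) * (\<Sum>j=1..k. v j)"
    using mult_left_mono[OF tail, of "real k"] mult_left_mono[OF head, of "real (n - k)"]
    by (simp add: algebra_simps)
  moreover have "(\<Sum>j=1..n. v j) = (\<Sum>j=1..k. v j) + (\<Sum>j=k+1..n. v j)"
    using sum.ub_add_nat[of 1 k v "n - k"] assms(1,2) by simp
  ultimately show ?thesis
    using assms(2) by (simp add: algebra_simps of_nat_diff)
qed

section \<open>Objective values of tuples and of weights\<close>

lemma scenario_value_le:
  assumes "i \<in> {1..k}"
  shows "scenario_value k x c \<le> c \<bullet> x i"
  unfolding scenario_value_def using assms by (intro Min_le) auto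

lemma scenario_value_attained:
  assumes "1 \<le> k"
  shows "\<exists>i\<in>{1..k}. scenario_value k x c = c \<bullet> x i"
  using Min_in[of "(\<lambda>i. c \<bullet> x i) ` {1..k}"] assms unfolding scenario_value_def by fastforce

text \<open>A real supremum is an upper bound only for a set that is bounded above; here the
  attained maximum supplies the bound.\<close>

lemma le_SUP_if_is_arg_max:
  fixes f :: "'a \<Rightarrow> real"
  assumes "is_arg_max f (\<lambda>c. c \<in> U) c\<^sub>0" and "c \<in> U"
  shows "f c \<le> (SUP c\<in>U. f c)"
  using assms by (intro cSUP_upper bdd_aboveI2[of _ _ "f c\<^sub>0"]) (auto simp: is_arg_max_linorder)

lemma scenario_value_le_m3_objective:
  assumes "optima_attained X U" and "1 \<le> k" and "x \<in> tuples k X" and "c \<in> U"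
  shows "scenario_value k x c \<le> m3_objective U k x"
proof -
  obtain c\<^sub>0 where "is_arg_max (scenario_value k x) (\<lambda>c. c \<in> U) c\<^sub>0"
    using assms(1-3) unfolding optima_attained_def by blast
  then show ?thesis
    unfolding m3_objective_def using \<open>c \<in> U\<close> by (rule le_SUP_if_is_arg_max)
qed

text \<open>Allowing more solutions cannot increase the optimum: any \<open>k\<close>-tuple extends
  to an \<open>n\<close>-tuple with repeated entries whose objective value is no larger.\<close>

lemma m3_objective_le_m3_opt:
  assumes "optima_attained X U" and "U \<noteq> {}" and "X \<noteq> {}"
    and opt: "m3_optimal X U n x" and "1 \<le> k" and "k \<le> n"
  shows "m3_objective U n x \<le> m3_opt X U k"
  unfolding m3_opt_def
proof (rule cINF_greatest)
  show "tuples k X \<noteq> {}"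
    using \<open>X \<noteq> {}\<close> by (simp add: PiE_eq_empty_iff)
next
  fix z
  assume z: "z \<in> tuples k X"
  \<comment> \<open>The padding repeats \<open>z 1\<close>, an entry that exists because
    \<open>1 \<le> k\<close>, so the longer tuple stays in \<open>X\<close>.\<close>
  define z' where "z' = (\<lambda>i\<in>{1..n}. if i \<le> k then z i else z 1)"
  have "z' \<in> tuples n X"
    using PiE_mem[OF z] \<open>1 \<le> k\<close> unfolding z'_def by (intro restrict_PiE_iff[THEN iffD2]) auto
  then have "m3_objective U n x \<le> m3_objective U n z'"
    using opt by (auto simp: m3_optimal_def is_arg_min_linorder)
  also have "\<dots> \<le> m3_objective U k z"
    unfolding m3_objective_def[of U n]
  proof (rule cSUP_least[OF \<open>U \<noteq> {}\<close>])
    fix c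
    assume "c \<in> U"
    obtain i where i: "i \<in> {1..k}" "scenario_value k z c = c \<bullet> z i"
      using scenario_value_attained[OF \<open>1 \<le> k\<close>] by blast
    have "scenario_value n z' c \<le> c \<bullet> z' i"
      using i \<open>k \<le> n\<close> by (intro scenario_value_le) auto
    also have "\<dots> = scenario_value k z c"
      using i \<open>k \<le> n\<close> by (simp add: z'_def)
    also have "\<dots> \<le> m3_objective U k z"
      using assms(1) \<open>1 \<le> k\<close> z \<open>c \<in> U\<close> by (rule scenario_value_le_m3_objective)
    finally show "scenario_value n z' c \<le> m3_objective U k z" .
  qed
  finally show "m3_objective U n x \<le> m3_objective U k z" .
qed

text \<open>Separation, with the objective value of \<open>x\<close> as threshold, yields some
  weights satisfying this bound in every scenario. Optimal weights have a worst case at most as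
  large.\<close>

lemma weights_optimal_le_m3_objective:
  fixes U :: "(real ^ 'n) set"
  assumes "optima_attained X U" and "U \<noteq> {}" and "convex U"
    and x: "x \<in> tuples CARD('n) X" and w: "weights_optimal U CARD('n) x w" and "c \<in> U"
  shows "c \<bullet> combination CARD('n) x w \<le> m3_objective U CARD('n) x"
proof -
  let ?n = "CARD('n)"
  have n: "1 \<le> ?n"
    by (simp add: Suc_leI)
  \<comment> \<open>The separation lemma indexes points by a finite type. Since the tuple has length
    \<open>CARD('n)\<close>, the coordinate type \<open>'n\<close> serves as that index type and
    \<open>h\<close> does the renumbering.\<close>
  obtain h :: "'n \<Rightarrow> nat" where h: "bij_betw h UNIV {1..?n}"
    using finite_same_card_bij[of "UNIV :: 'n set" "{1..?n}"] by auto
  have "\<exists>i. d \<bullet> x (h i) \<le> m3_objective U ?n x" if "d \<in> U" for d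
  proof -
    obtain j where j: "j \<in> {1..?n}" "scenario_value ?n x d = d \<bullet> x j"
      using scenario_value_attained[OF n] by blast
    have "scenario_value ?n x d \<le> m3_objective U ?n x"
      using assms(1) n x that by (rule scenario_value_le_m3_objective)
    moreover obtain i where "h i = j"
      using h j(1) by (metis bij_betw_imp_surj_on imageE)
    ultimately show ?thesis
      using j(2) by auto
  qed
  then have "\<exists>u. (\<forall>i. 0 \<le> u i) \<and> (\<Sum>i\<in>UNIV. u i) = 1 \<and>
      (\<forall>d\<in>U. d \<bullet> (\<Sum>i\<in>UNIV. u i *\<^sub>R x (h i)) \<le> m3_objective U ?n x)"
    by (rule convex_weights_le_if_min_le[OF \<open>convex U\<close> \<open>U \<noteq> {}\<close>])
  then obtain u where u: "\<And>i. 0 \<le> u i" "(\<Sum>i\<in>UNIV. u i) = 1"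
      "\<And>d. d \<in> U \<Longrightarrow> d \<bullet> (\<Sum>i\<in>UNIV. u i *\<^sub>R x (h i)) \<le> m3_objective U ?n x"
    by auto
  \<comment> \<open>The weights are carried back to numerical indices; values of \<open>u'\<close>
    outside \<open>{1..CARD('n)}\<close> enter neither the simplex condition nor the
    combination.\<close>
  define u' where "u' j = u (inv h j)" for j
  have inv: "inv h (h i) = i" for i
    using h by (simp add: bij_betw_def)
  have "(\<Sum>j=1..?n. u' j) = 1"
    using sum.reindex_bij_betw[OF h, of u'] u(2) by (simp add: u'_def inv)
  then have u'_simplex: "u' \<in> simplex_weights ?n"
    using u(1) by (simp add: simplex_weights_def u'_def)
  have u'_comb: "combination ?n x u' = (\<Sum>i\<in>UNIV. u i *\<^sub>R x (h i))"
    using sum.reindex_bij_betw[OF h, of "\<lambda>j. u' j *\<^sub>R x j"]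
    by (simp add: combination_def u'_def inv)
  have "w \<in> simplex_weights ?n"
    using w by (simp add: weights_optimal_def is_arg_min_linorder)
  then obtain c\<^sub>0 where "is_arg_max (\<lambda>c. c \<bullet> combination ?n x w) (\<lambda>c. c \<in> U) c\<^sub>0"
    using assms(1) x unfolding optima_attained_def by blast
  then have "c \<bullet> combination ?n x w \<le> weights_objective U ?n x w"
    unfolding weights_objective_def using \<open>c \<in> U\<close> by (rule le_SUP_if_is_arg_max)
  also have "\<dots> \<le> weights_objective U ?n x u'"
    using w u'_simplex by (simp add: weights_optimal_def is_arg_min_linorder)
  also have "\<dots> \<le> m3_objective U ?n x"
    unfolding weights_objective_def u'_comb using \<open>U \<noteq> {}\<close> u(3) by (rule cSUP_least)
  finally show ?thesis .
qed

section \<open>The loss from dropping the smallest weights\<close>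

lemma inner_zero_one_bounds:
  fixes c x :: "real ^ 'n"
  assumes "\<And>j. x $ j \<in> {0, 1}" and "\<And>j. m \<le> c $ j" and "\<And>j. c $ j \<le> M"
  shows "m * real (l0 x) \<le> c \<bullet> x" and "c \<bullet> x \<le> M * real (l0 x)"
proof -
  let ?S = "{j. x $ j \<noteq> 0}"
  have "c \<bullet> x = (\<Sum>j\<in>?S. c $ j * x $ j)"
    unfolding inner_vec_def inner_real_def by (intro sum.mono_neutral_right) auto
  also have "\<dots> = (\<Sum>j\<in>?S. c $ j)"
    using assms(1) by (intro sum.cong) fastforce+
  finally have eq: "c \<bullet> x = (\<Sum>j\<in>?S. c $ j)" .
  show "m * real (l0 x) \<le> c \<bullet> x"
    using sum_bounded_below[of ?S m "\<lambda>j. c $ j"] assms(2) by (simp add: eq l0_def mult.commute)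
  show "c \<bullet> x \<le> M * real (l0 x)"
    using sum_bounded_above[of ?S "\<lambda>j. c $ j" M] assms(3) by (simp add: eq l0_def mult.commute)
qed

text \<open>Let \<open>s\<close> be the value of the selection in scenario \<open>c\<close>. Each
  kept solution costs at least \<open>s\<close>, and each dropped one at least
  \<open>L \<ge> s - (H - L)\<close>, because \<open>s \<le> H\<close>. Averaging with the weights
  loses at most \<open>H - L\<close> times the dropped weight, which sorting limits to
  \<open>(n - k) / n\<close>.\<close>

lemma scenario_value_selection_le:
  assumes w: "w \<in> simplex_weights n" and \<sigma>: "bij_betw \<sigma> {1..n} {1..n}"
    and sorted: "\<And>i j. i \<in> {1..n} \<Longrightarrow> j \<in> {1..n} \<Longrightarrow> i \<le> j \<Longrightarrow> w (\<sigma> j) \<le> w (\<sigma> i)"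
    and "1 \<le> k" and "k \<le> n"
    and lo: "\<And>i. i \<in> {1..n} \<Longrightarrow> L \<le> c \<bullet> x i" and hi: "\<And>i. i \<in> {1..n} \<Longrightarrow> c \<bullet> x i \<le> H"
  shows "scenario_value k (\<lambda>j\<in>{1..k}. x (\<sigma> j)) c
    \<le> c \<bullet> combination n x w + real (n - k) / real n * (H - L)"
proof -
  let ?y = "\<lambda>j\<in>{1..k}. x (\<sigma> j)"
  let ?v = "\<lambda>j. w (\<sigma> j)"
  define s where "s = scenario_value k ?y c"
  have \<sigma>_in: "\<sigma> j \<in> {1..n}" if "j \<in> {1..n}" for j
    using \<sigma> that by (rule bij_betw_apply)
  have s_le: "s \<le> c \<bullet> x (\<sigma> j)" if "j \<in> {1..k}" for j
    using scenario_value_le[OF that, of ?y c] that by (simp add: s_def)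
  have "s \<le> H"
    using s_le[of 1] hi[OF \<sigma>_in, of 1] assms(4,5) by simp
  have "L \<le> H"
    using lo[of 1] hi[of 1] assms(4,5) by simp
  have v_nonneg: "0 \<le> ?v j" if "j \<in> {1..n}" for j
    using w \<sigma>_in[OF that] by (simp add: simplex_weights_def)
  have v_sum: "(\<Sum>j=1..n. ?v j) = 1"
    using w sum.reindex_bij_betw[OF \<sigma>, of w] by (simp add: simplex_weights_def)
  have split: "(\<Sum>j=1..n. g j) = (\<Sum>j=1..k. g j) + (\<Sum>j=k+1..n. g j)" for g :: "nat \<Rightarrow> real"
    using sum.ub_add_nat[of 1 k g "n - k"] assms(4,5) by simp
  define T where "T = (\<Sum>j=k+1..n. ?v j)"
  have "real n * T \<le> real (n - k)"
    using decreasing_tail_sum_le[of k n ?v] sorted assms(4,5) v_sum by (simp add: T_def)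
  then have T: "T \<le> real (n - k) / real n"
    using assms(4,5) by (simp add: field_simps)
  \<comment> \<open>The total weight one is spread over \<open>s\<close>, so that the correction
    \<open>H - L\<close> is charged only to the dropped indices and the terms can be compared one by
    one.\<close>
  have "s - T * (H - L) = (\<Sum>j=1..n. ?v j) * s - T * (H - L)"
    unfolding v_sum by simp
  also have "\<dots> = (\<Sum>j=1..k. ?v j * s) + (\<Sum>j=k+1..n. ?v j * (s - (H - L)))"
    unfolding split T_def
    by (simp add: algebra_simps sum_subtractf sum.distrib flip: sum_distrib_left sum_distrib_right)
  also have "\<dots> \<le> (\<Sum>j=1..k. ?v j * (c \<bullet> x (\<sigma> j))) + (\<Sum>j=k+1..n. ?v j * (c \<bullet> x (\<sigma> j)))"
  proof (intro add_mono sum_mono mult_left_mono)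
    show "s - (H - L) \<le> c \<bullet> x (\<sigma> j)" if "j \<in> {k+1..n}" for j
      using lo[OF \<sigma>_in, of j] \<open>s \<le> H\<close> that by simp
  qed (use s_le v_nonneg assms(5) in auto)
  also have "\<dots> = c \<bullet> combination n x w"
    using sum.reindex_bij_betw[OF \<sigma>, of "\<lambda>i. w i * (c \<bullet> x i)"]
    unfolding split[symmetric] by (simp add: combination_def inner_sum_right)
  finally have "s \<le> c \<bullet> combination n x w + T * (H - L)"
    by simp
  also have "T * (H - L) \<le> real (n - k) / real n * (H - L)"
    using T \<open>L \<le> H\<close> by (intro mult_right_mono) auto
  finally show ?thesis
    by (simp add: s_def)
qed

theorem lemma5:
  fixes C :: "((real ^ 'n) set \<times> (real ^ 'n) set) set"
    and X U :: "(real ^ 'n) set"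
    and p_lo p_up a M :: "nat \<Rightarrow> real"
    and m_inf M_inf :: real
    and n k l :: nat
    and y :: "nat \<Rightarrow> real ^ 'n"
  assumes "n = CARD('n)"
    and "problem_class C"
    and "cardinality_bounds C p_lo p_up"
    and "(X, U) \<in> C"
    and "optima_attained X U"
    and "cost_bounds U m_inf M_inf"
    and "M = (\<lambda>m. M_inf * p_up m - m_inf * p_lo m)"
    and "\<forall>m\<ge>1. 0 \<le> a m"
    and "M n + a n > 0"
    and "l \<in> {1..n - 1}"
    and "k = n - l"
    and "real l \<le> min (real n - 1) (a n * real n / (M n + a n))"
    and "selection_output X U k y"
  shows "m3_objective U k y \<le> m3_opt X U k + a n"
proof -
  have n: "1 \<le> n" and k: "1 \<le> k" "k \<le> n" "n - k = l"
    using assms(10,11) by auto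
  have "m3_instance X U"
    using assms(2,4) by (auto simp: problem_class_def)
  then have inst: "U \<noteq> {}" "X \<noteq> {}" "convex U" and X01: "\<And>z j. z \<in> X \<Longrightarrow> z $ j \<in> {0, 1}"
    unfolding m3_instance_def by blast+
  have cost: "0 < m_inf" "m_inf \<le> M_inf" "\<And>c j. c \<in> U \<Longrightarrow> m_inf \<le> c $ j"
      "\<And>c j. c \<in> U \<Longrightarrow> c $ j \<le> M_inf"
    using assms(6) by (auto simp: cost_bounds_def)
  have card: "p_lo n \<le> real (l0 z)" "real (l0 z) \<le> p_up n" if "z \<in> X" for z
    using assms(1,3,4) that by (auto simp: cardinality_bounds_def)
  have lo: "m_inf * p_lo n \<le> c \<bullet> z" and hi: "c \<bullet> z \<le> M_inf * p_up n"
    if "c \<in> U" "z \<in> X" for c z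
  proof -
    have "m_inf * p_lo n \<le> m_inf * real (l0 z)" "M_inf * real (l0 z) \<le> M_inf * p_up n"
      using card[OF that(2)] cost(1,2) by (auto intro: mult_left_mono)
    moreover have "m_inf * real (l0 z) \<le> c \<bullet> z" "c \<bullet> z \<le> M_inf * real (l0 z)"
      using X01 cost(3,4) that by (auto intro!: inner_zero_one_bounds)
    ultimately show "m_inf * p_lo n \<le> c \<bullet> z" "c \<bullet> z \<le> M_inf * p_up n"
      by linarith+
  qed
  \<comment> \<open>Clearing the positive denominator \<open>M n + a n\<close> and discarding the
    non-negative term \<open>l * a n\<close> turns the bound on \<open>l\<close> into
    \<open>l / n * M n \<le> a n\<close>.\<close>
  have "real l * (M n + a n) \<le> a n * real n"
    using assms(9,12) by (simp add: field_simps)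
  moreover have "0 \<le> real l * a n"
    using assms(8) n by simp
  ultimately have l_bound: "real l / real n * M n \<le> a n"
    using n by (simp add: field_simps)
  obtain x w \<sigma> where x: "m3_optimal X U n x" and w: "weights_optimal U n x w"
    and \<sigma>: "bij_betw \<sigma> {1..n} {1..n}"
    and sorted: "\<And>i j. i \<in> {1..n} \<Longrightarrow> j \<in> {1..n} \<Longrightarrow> i \<le> j \<Longrightarrow> w (\<sigma> j) \<le> w (\<sigma> i)"
    and y: "y = (\<lambda>j\<in>{1..k}. x (\<sigma> j))"
    using assms(13) unfolding selection_output_def assms(1) by blast
  have x_tuple: "x \<in> tuples n X"
    using x by (simp add: m3_optimal_def is_arg_min_linorder)
  have w_simplex: "w \<in> simplex_weights n"
    using w by (simp add: weights_optimal_def is_arg_min_linorder)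
  show ?thesis
    unfolding m3_objective_def
  proof (rule cSUP_least[OF inst(1)])
    fix c
    assume c: "c \<in> U"
    \<comment> \<open>Here \<open>L = m_inf * p_lo n\<close> and \<open>H = M_inf * p_up n\<close>,
      so \<open>H - L\<close> is exactly \<open>M n\<close>, and \<open>n - k = l\<close> solutions
      are dropped.\<close>
    have "scenario_value k y c \<le> c \<bullet> combination n x w + real l / real n * M n"
      unfolding y assms(7) k(3)[symmetric]
      using x_tuple c
      by (intro scenario_value_selection_le[OF w_simplex \<sigma> sorted k(1,2)] lo hi) auto
    \<comment> \<open>The weighted combination is compared with the optimal \<open>n\<close>-tuple
      \<open>x\<close>, whose value in turn is at most \<open>opt(k)\<close> because
      \<open>k \<le> n\<close>.\<close>
    also have "\<dots> \<le> m3_objective U n x + a n"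
      using weights_optimal_le_m3_objective[OF assms(5) inst(1,3) _ _ c, of x w]
        x_tuple w l_bound assms(1) by simp
    also have "\<dots> \<le> m3_opt X U k + a n"
      using m3_objective_le_m3_opt[OF assms(5) inst(1,2) x k(1,2)] by simp
    finally show "scenario_value k y c \<le> m3_opt X U k + a n" .
  qed
qed

end
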